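(* $\mathrm{Fin}(6)=\mathrm{Adm}(6)$.
   Context: $K_4-e$ is the graph on four vertices $a,b,c,d$ with edges $ab,ac,ad,bc,bd$; it is denoted $[a,b,c-d]$. A $(K_4-e)$-design of order $v$ is a pair $(X,\mathcal B)$ where $X$ is a set of $v$ vertices and $\mathcal B$ is a collection of copies of $K_4-e$ (blocks) with vertices in $X$ whose edge sets partition the edges of $K_v$ on $X$; it has $b_v=v(v-1)/10$ blocks. For a graph $B$, $T(B)$ is the set of its triangles (3-vertex subsets inducing a triangle); e.g. $T([a,b,c-d])=\{\{a,b,c\},\{a,b,d\}\}$, and $T(\mathcal B)=\bigcup_{B\in\mathcal B}T(B)$. Two designs $(X,\mathcal B_1),(X,\mathcal B_2)$ on the same vertex set intersect in $s$ blocks if $|\mathcal B_1\cap\mathcal B_2|=s$, and in $t$ triangles if $|T(\mathcal B_1)\cap T(\mathcal B_2)|=t$. Define $\mathrm{Fin}(v)=\{(s,t):$ there exists a pair of $(K_4-e)$-designs of order $v$ on the same vertex set intersecting in $s$ blocks and $t+2s$ triangles$\}$; $J(v)=\{s:$ there is a pair of $(K_4-e)$-designs of order $v$ intersecting in $s$ blocks$\}$; $J_T(v)=\{t:$ there is a pair of $(K_4-e)$-designs of order $v$ intersecting in $t$ triangles$\}$; and $\mathrm{Adm}(v)=\{(s,t): s,t\ge 0,\ s+t\le b_v,\ s\in J(v),\ t+2s\in J_T(v)\}$. (Known from the literature: $J(6)=\{0,3\}$ and $J_T(6)=\{0,2,3,6\}$, so $\mathrm{Adm}(6)=\{(0,0),(0,2),(0,3),(3,0)\}$.)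 *)

theory Defs
  imports Main
begin

text \<open>A copy of K4-e written [a,b,c-d], represented by its edge set
  (edges are 2-element sets); a graph without isolated vertices is determined by its edges.\<close>
definition kfe :: "'a \<Rightarrow> 'a \<Rightarrow> 'a \<Rightarrow> 'a \<Rightarrow> 'a set set" where
  "kfe a b c d = {{a,b},{a,c},{a,d},{b,c},{b,d}}"

definition is_block :: "'a set \<Rightarrow> 'a set set \<Rightarrow> bool" where
  "is_block X B \<longleftrightarrow> (\<exists>a b c d. a \<in> X \<and> b \<in> X \<and> c \<in> X \<and> d \<in> X \<and>
     distinct [a,b,c,d] \<and> B = kfe a b c d)"

definition is_design :: "'a set \<Rightarrow> 'a set set set \<Rightarrow> bool" where
  "is_design X Bs \<longleftrightarrow> finite X \<and> (\<forall>B\<in>Bs. is_block X B) \<and>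
     (\<forall>x\<in>X. \<forall>y\<in>X. x \<noteq> y \<longrightarrow> (\<exists>!B. B \<in> Bs \<and> {x,y} \<in> B))"

definition triangles :: "'a set set \<Rightarrow> 'a set set" where
  "triangles G = {S. card S = 3 \<and> (\<forall>x\<in>S. \<forall>y\<in>S. x \<noteq> y \<longrightarrow> {x,y} \<in> G)}"

definition Tri :: "'a set set set \<Rightarrow> 'a set set" where
  "Tri Bs = (\<Union>B\<in>Bs. triangles B)"

definition b_num :: "nat \<Rightarrow> nat" where
  "b_num v = v * (v - 1) div 10"

text \<open>Vertex sets are taken as finite sets of naturals of size v (any v-set can be relabelled).\<close>
definition Fin :: "nat \<Rightarrow> (nat \<times> nat) set" where
  "Fin v = {(s,t). \<exists>(X::nat set) B1 B2. card X = v \<and> is_design X B1 \<and> is_design X B2 \<and>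
      card (B1 \<inter> B2) = s \<and> card (Tri B1 \<inter> Tri B2) = t + 2 * s}"

definition J :: "nat \<Rightarrow> nat set" where
  "J v = {s. \<exists>(X::nat set) B1 B2. card X = v \<and> is_design X B1 \<and> is_design X B2 \<and>
      card (B1 \<inter> B2) = s}"

definition J_T :: "nat \<Rightarrow> nat set" where
  "J_T v = {t. \<exists>(X::nat set) B1 B2. card X = v \<and> is_design X B1 \<and> is_design X B2 \<and>
      card (Tri B1 \<inter> Tri B2) = t}"

definition Adm :: "nat \<Rightarrow> (nat \<times> nat) set" where
  "Adm v = {(s,t). s + t \<le> b_num v \<and> s \<in> J v \<and> t + 2 * s \<in> J_T v}"

end

theory Submission
  imports Defs
begin

text \<open>
  A vertex has degree 5 = 3 + 2, so one block \<open>[a,b,c-d]\<close> of a design on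
  \<open>{a,b,c,d,e,f}\<close> forces the block \<open>[e,f,a-b]\<close>, and the five edges left over form \<open>[c,d,e-f]\<close>.
  Hence a design of order 6 is a cyclically ordered perfect matching, two designs sharing a block
  are equal, and the possible numbers of common triangles of two distinct designs are found by
  running through the designs having a given vertex in their first pair.
\<close>

section \<open>The cyclic designs and their triangles\<close>

text \<open>The edges of \<open>kfe a b c d\<close> are the pair {a,b} itself and the four edges
  joining it to {c,d}. The blocks thus go once around the matching ab, cd, ef, each pair being
  joined to the next.\<close>

definition cyc :: "'a \<Rightarrow> 'a \<Rightarrow> 'a \<Rightarrow> 'a \<Rightarrow> 'a \<Rightarrow> 'a \<Rightarrow> 'a set set set" where
  "cyc a b c d e f = {kfe a b c d, kfe c d e f, kfe e f a b}"

text \<open>An explicit finite set, so that intersections can be counted by evaluation, which the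
  comprehension behind \<open>Tri\<close> does not allow directly.\<close>

definition cyc_tri :: "'a \<Rightarrow> 'a \<Rightarrow> 'a \<Rightarrow> 'a \<Rightarrow> 'a \<Rightarrow> 'a \<Rightarrow> 'a set set" where
  "cyc_tri a b c d e f = {{a,b,c}, {a,b,d}, {c,d,e}, {c,d,f}, {e,f,a}, {e,f,b}}"

lemma kfe_swap: "kfe b a c d = kfe a b c d" "kfe a b d c = kfe a b c d"
  unfolding kfe_def by (auto simp: insert_commute)

text \<open>Rotations together with swaps inside a pair can bring any vertex to the first
  position.\<close>

lemma cyc_rotate: "cyc c d e f a b = cyc a b c d e f"
  unfolding cyc_def by auto

lemma cyc_swap: "cyc b a c d e f = cyc a b c d e f"
  unfolding cyc_def by (simp add: kfe_swap)

lemma cyc_swap': "cyc a b d c e f = cyc a b c d e f" "cyc a b c d f e = cyc a b c d e f"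
  unfolding cyc_def by (simp_all add: kfe_swap)

text \<open>The vertices \<open>c\<close> and \<open>d\<close> are not adjacent, so a triangle
  misses one of them; it then lies in one of the two listed 3-sets and equals it by
  cardinality.\<close>

lemma triangles_kfe:
  assumes "distinct [a,b,c,d]"
  shows "triangles (kfe a b c d) = {{a,b,c}, {a,b,d}}"
proof
  show "triangles (kfe a b c d) \<subseteq> {{a,b,c}, {a,b,d}}"
  proof
    fix S assume S: "S \<in> triangles (kfe a b c d)"
    then have card: "card S = 3" and edge: "\<And>x y. x \<in> S \<Longrightarrow> y \<in> S \<Longrightarrow> x \<noteq> y \<Longrightarrow> {x,y} \<in> kfe a b c d"
      by (auto simp: triangles_def)
    have "S \<subseteq> {a,b,c,d}"
    proof
      fix x assume x: "x \<in> S"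
      have "S \<noteq> {x}" using card by auto
      then obtain y where "y \<in> S" "x \<noteq> y" using x by blast
      from edge[OF x this] show "x \<in> {a,b,c,d}"
        by (auto simp: kfe_def doubleton_eq_iff)
    qed
    moreover have "\<not> (c \<in> S \<and> d \<in> S)"
      using edge[of c d] assms by (auto simp: kfe_def doubleton_eq_iff)
    ultimately consider "S \<subseteq> {a,b,c}" | "S \<subseteq> {a,b,d}" by auto
    then show "S \<in> {{a,b,c}, {a,b,d}}"
    proof cases
      case 1
      then have "S = {a,b,c}" using card assms by (intro card_subset_eq) auto
      then show ?thesis by simp
    next
      case 2
      then have "S = {a,b,d}" using card assms by (intro card_subset_eq) auto
      then show ?thesis by simp
    qed
  qed
  show "{{a,b,c}, {a,b,d}} \<subseteq> triangles (kfe a b c d)"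
    using assms by (auto simp: triangles_def kfe_def insert_commute)
qed

lemma Tri_cyc:
  assumes "distinct [a,b,c,d,e,f]"
  shows "Tri (cyc a b c d e f) = cyc_tri a b c d e f"
proof -
  have "distinct [a,b,c,d]" "distinct [c,d,e,f]" "distinct [e,f,a,b]" using assms by auto
  from this[THEN triangles_kfe] show ?thesis
    by (simp only: Tri_def cyc_def cyc_tri_def UN_insert UN_empty Un_insert_left Un_empty_left)
qed

lemma kfe_disjoint:
  assumes "distinct [a,b,c,d,e,f]"
  shows "kfe a b c d \<inter> kfe c d e f = {}"
  using assms by (auto simp: kfe_def doubleton_eq_iff)

lemma kfe_cover:
  assumes "x \<in> {a,b,c,d,e,f}" "y \<in> {a,b,c,d,e,f}" "x \<noteq> y"
  shows "{x,y} \<in> kfe a b c d \<union> kfe c d e f \<union> kfe e f a b"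
  using assms unfolding kfe_def
  by (elim insertE emptyE) (simp_all add: doubleton_eq_iff)

lemma is_block_kfe:
  assumes "a \<in> X" "b \<in> X" "c \<in> X" "d \<in> X" "distinct [a,b,c,d]"
  shows "is_block X (kfe a b c d)"
  using assms unfolding is_block_def by metis

lemma is_block_edgeE:
  assumes "is_block X B" "E \<in> B"
  obtains x y where "x \<in> X" "y \<in> X" "x \<noteq> y" "E = {x,y}"
proof -
  obtain a b c d where "a \<in> X" "b \<in> X" "c \<in> X" "d \<in> X" "distinct [a,b,c,d]" "B = kfe a b c d"
    using assms(1) unfolding is_block_def by blast
  moreover then have "E = {a,b} \<or> E = {a,c} \<or> E = {a,d} \<or> E = {b,c} \<or> E = {b,d}"
    using assms(2) by (simp add: kfe_def)
  ultimately show thesis using that by (elim disjE) simp_all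
qed

lemma is_design_cyc:
  assumes dist: "distinct [a,b,c,d,e,f]"
  shows "is_design {a,b,c,d,e,f} (cyc a b c d e f)"
proof -
  have disj: "kfe a b c d \<inter> kfe c d e f = {}" "kfe c d e f \<inter> kfe e f a b = {}"
    "kfe e f a b \<inter> kfe a b c d = {}"
    using dist by (auto intro!: kfe_disjoint)
  show ?thesis
    unfolding is_design_def
  proof (intro conjI ballI impI)
    show "is_block {a,b,c,d,e,f} B" if "B \<in> cyc a b c d e f" for B
      using that dist unfolding cyc_def by (auto intro!: is_block_kfe)
    show "\<exists>!B. B \<in> cyc a b c d e f \<and> {x,y} \<in> B"
      if "x \<in> {a,b,c,d,e,f}" "y \<in> {a,b,c,d,e,f}" "x \<noteq> y" for x y
      using kfe_cover[OF that] disj unfolding cyc_def by blast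
  qed simp
qed

lemma card_kfe:
  assumes "distinct [a,b,c,d]"
  shows "card (kfe a b c d) = 5"
  using assms by (simp add: kfe_def doubleton_eq_iff)

lemma card_cyc:
  assumes "distinct [a,b,c,d,e,f]"
  shows "card (cyc a b c d e f) = 3"
proof -
  have "kfe a b c d \<noteq> kfe c d e f" "kfe c d e f \<noteq> kfe e f a b" "kfe a b c d \<noteq> kfe e f a b"
    using kfe_disjoint[of a b c d e f] kfe_disjoint[of c d e f a b] kfe_disjoint[of e f a b c d] assms
      card_kfe[of a b c d] card_kfe[of c d e f]
    by force+
  then show ?thesis by (simp add: cyc_def)
qed

section \<open>Every design of order 6 is cyclic\<close>

text \<open>The first two vertices of a block have three neighbours each. As \<open>a\<close> has at
  most the neighbours \<open>e\<close> and \<open>f\<close>, it is one of the last two vertices, and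
  the first two are then \<open>e\<close> and \<open>f\<close>.\<close>

lemma is_block_degree_two:
  assumes B: "is_block X B" and "{a,e} \<in> B" "a \<noteq> e"
    and only: "\<And>x. {a,x} \<in> B \<Longrightarrow> x = e \<or> x = f"
  obtains y where "B = kfe e f a y"
proof -
  obtain p q r s where pq: "p \<in> X" "q \<in> X" "r \<in> X" "s \<in> X" "distinct [p,q,r,s]" "B = kfe p q r s"
    using B unfolding is_block_def by blast
  have edges: "{p,q} \<in> B" "{p,r} \<in> B" "{p,s} \<in> B" "{q,p} \<in> B" "{q,r} \<in> B" "{q,s} \<in> B"
    "{r,p} \<in> B" "{r,q} \<in> B" "{s,p} \<in> B" "{s,q} \<in> B"
    unfolding pq(6) kfe_def by (auto simp: insert_commute)
  have "a \<in> {p,q,r,s}"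
    using assms(2) pq(6) by (auto simp: kfe_def doubleton_eq_iff)
  moreover have "a \<noteq> p"
    using only[of q] only[of r] only[of s] edges pq(5) by auto
  moreover have "a \<noteq> q"
    using only[of p] only[of r] only[of s] edges pq(5) by auto
  ultimately consider "a = r" | "a = s" by auto
  then show thesis
  proof cases
    case 1
    then have "p = e \<and> q = f \<or> p = f \<and> q = e"
      using only[of p] only[of q] edges pq(5) by auto
    then show thesis using that[of s] pq 1 by (auto simp: kfe_swap)
  next
    case 2
    then have "p = e \<and> q = f \<or> p = f \<and> q = e"
      using only[of p] only[of q] edges pq(5) by auto
    then show thesis using that[of r] pq 2 by (auto simp: kfe_swap)
  qed
qed

lemma is_design_eq_cyc:
  assumes design: "is_design X Bs" and X: "X = {a,b,c,d,e,f}" and dist: "distinct [a,b,c,d,e,f]"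
    and B: "kfe a b c d \<in> Bs"
  shows "Bs = cyc a b c d e f"
proof -
  have block: "\<And>B. B \<in> Bs \<Longrightarrow> is_block X B"
    and ex1: "\<And>x y. x \<in> X \<Longrightarrow> y \<in> X \<Longrightarrow> x \<noteq> y \<Longrightarrow> \<exists>!B. B \<in> Bs \<and> {x,y} \<in> B"
    using design unfolding is_design_def by auto
  have edge: "\<exists>x\<in>X. \<exists>y\<in>X. x \<noteq> y \<and> E = {x,y}" if "C \<in> Bs" "E \<in> C" for C E
    using is_block_edgeE[OF block[OF that(1)] that(2)] by metis
  have uniq: "C = D" if CD: "C \<in> Bs" "D \<in> Bs" "E \<in> C" "E \<in> D" for C D E
  proof -
    obtain x y where "x \<in> X" "y \<in> X" "x \<noteq> y" "E = {x,y}" using edge[OF CD(1,3)] by blast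
    then show ?thesis using ex1[of x y] CD by blast
  qed
  \<comment> \<open>The given block uses up the edges from \<open>u\<close> to the rest of
    {a,b,c,d}, so in the block through {u,e} the vertex \<open>u\<close> can only be adjacent to
    \<open>e\<close> and \<open>f\<close>.\<close>
  have opp: "\<exists>y. kfe e f u y \<in> Bs \<and> {u,e} \<in> kfe e f u y" if u: "u \<in> {a,b}" for u
  proof -
    obtain C where C: "C \<in> Bs" "{u,e} \<in> C" using ex1[of u e] X dist u by auto
    have "{u,e} \<notin> kfe a b c d" using dist u by (auto simp: kfe_def doubleton_eq_iff)
    then have "C \<noteq> kfe a b c d" using C(2) by blast
    then have disj: "C \<inter> kfe a b c d = {}" using uniq[OF C(1) B] by blast
    have only: "x = e \<or> x = f" if x: "{u,x} \<in> C" for x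
    proof -
      have "x \<in> X" "x \<noteq> u" using edge[OF C(1) x] by (auto simp: doubleton_eq_iff)
      have "x \<notin> {a,b,c,d}"
      proof
        assume "x \<in> {a,b,c,d}"
        then have "{u,x} \<in> kfe a b c d"
          using u \<open>x \<noteq> u\<close> by (elim insertE emptyE) (simp_all add: kfe_def doubleton_eq_iff)
        then show False using disj x by blast
      qed
      with \<open>x \<in> X\<close> show ?thesis using X by blast
    qed
    have "u \<noteq> e" using u dist by auto
    then obtain y where "C = kfe e f u y"
      using is_block_degree_two[OF block[OF C(1)] C(2)] only by metis
    then show ?thesis using C by blast
  qed
  obtain y where y: "kfe e f a y \<in> Bs" using opp[of a] by auto
  obtain z where z: "kfe e f b z \<in> Bs" "{b,e} \<in> kfe e f b z" using opp[of b] by auto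
  \<comment> \<open>The blocks found for \<open>a\<close> and for \<open>b\<close> share the edge
    {e,f}, so they coincide; since the edge {b,e} lies in this block, its fourth vertex is
    \<open>b\<close>.\<close>
  have "kfe e f a y = kfe e f b z"
    by (rule uniq[OF y z(1), of "{e,f}"]) (auto simp: kfe_def)
  then have "{b,e} \<in> kfe e f a y" using z by simp
  then have "y = b" using dist by (auto simp: kfe_def doubleton_eq_iff)
  with y have B2: "kfe e f a b \<in> Bs" by simp
  \<comment> \<open>The pair {c,d} is an edge of neither block found so far. Its block avoids both,
    so it lies within the five remaining edges, and having five edges itself it consists of exactly
    these.\<close>
  obtain C where C: "C \<in> Bs" "{c,d} \<in> C" using ex1[of c d] X dist by auto
  have "{c,d} \<notin> kfe a b c d" "{c,d} \<notin> kfe e f a b"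
    using dist by (auto simp: kfe_def doubleton_eq_iff)
  then have "C \<noteq> kfe a b c d" "C \<noteq> kfe e f a b"
    using C(2) by blast+
  then have disj: "C \<inter> kfe a b c d = {}" "C \<inter> kfe e f a b = {}"
    using uniq[OF C(1) B] uniq[OF C(1) B2] by blast+
  have cover: "{x,y} \<in> kfe a b c d \<union> kfe c d e f \<union> kfe e f a b"
    if "x \<in> X" "y \<in> X" "x \<noteq> y" for x y
    using that unfolding X by (rule kfe_cover)
  have "C \<subseteq> kfe c d e f"
  proof
    fix E assume E: "E \<in> C"
    then obtain x y where "x \<in> X" "y \<in> X" "x \<noteq> y" "E = {x,y}" using edge[OF C(1)] by blast
    then show "E \<in> kfe c d e f" using cover[of x y] disj E by blast
  qed
  moreover have "card C = 5"
    using block[OF C(1)] card_kfe unfolding is_block_def by metis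
  moreover have "finite (kfe c d e f)" "card (kfe c d e f) = 5"
    using dist by (simp add: kfe_def, simp add: card_kfe)
  ultimately have "C = kfe c d e f"
    by (intro card_subset_eq) auto
  with C have B3: "kfe c d e f \<in> Bs" by simp
  have "D \<in> cyc a b c d e f" if D: "D \<in> Bs" for D
  proof -
    \<comment> \<open>A further block would have an edge, but every edge is already covered by one
      of the three blocks.\<close>
    obtain E where E: "E \<in> D" using block[OF D] unfolding is_block_def kfe_def by blast
    then obtain x y where "x \<in> X" "y \<in> X" "x \<noteq> y" "E = {x,y}" using edge[OF D] by blast
    then have "E \<in> kfe a b c d \<union> kfe c d e f \<union> kfe e f a b" using cover by blast
    then show ?thesis using uniq[OF D B E] uniq[OF D B2 E] uniq[OF D B3 E]
      unfolding cyc_def by blast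
  qed
  then show ?thesis using B B2 B3 unfolding cyc_def by blast
qed

lemma block_extends:
  assumes "card X = 6" "is_block X B"
  obtains a b c d e f where "distinct [a,b,c,d,e,f]" "X = {a,b,c,d,e,f}" "B = kfe a b c d"
proof -
  obtain a b c d where abcd: "{a,b,c,d} \<subseteq> X" "distinct [a,b,c,d]" "B = kfe a b c d"
    using assms(2) unfolding is_block_def by auto
  have "finite X" using assms(1) card.infinite by fastforce
  have "card (X - {a,b,c,d}) = 2"
    using abcd assms(1) by (subst card_Diff_subset) auto
  then obtain e f where ef: "X - {a,b,c,d} = {e,f}" "e \<noteq> f" by (auto simp: card_2_iff)
  then have "X = {a,b,c,d,e,f}" using abcd(1) by blast
  moreover have "e \<notin> {a,b,c,d}" "f \<notin> {a,b,c,d}" using ef by blast+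
  then have "distinct [a,b,c,d,e,f]" using ef(2) abcd(2) by auto
  ultimately show thesis using that abcd(3) by blast
qed

text \<open>Prescribing the first vertex lets two designs be written with the same \<open>z\<close>
  in front, so that comparing them involves only the arrangements of the other five
  vertices.\<close>

lemma is_design_cases:
  assumes "card X = 6" "is_design X Bs" "z \<in> X"
  obtains b c d e f where "distinct [z,b,c,d,e,f]" "X = {z,b,c,d,e,f}" "Bs = cyc z b c d e f"
proof -
  \<comment> \<open>A second vertex gives an edge at \<open>z\<close>, and hence a block to start
    from.\<close>
  have "\<exists>y\<in>X. y \<noteq> z"
  proof (rule ccontr)
    assume "\<not> ?thesis"
    then have "X \<subseteq> {z}" by blast
    then have "card X \<le> card {z}" by (intro card_mono) auto
    then show False using assms(1) by simp
  qed
  then obtain B where B: "B \<in> Bs" using assms(2,3) unfolding is_design_def by blast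
  then have "is_block X B" using assms(2) unfolding is_design_def by blast
  with assms(1) obtain a b c d e f where D: "distinct [a,b,c,d,e,f]" "X = {a,b,c,d,e,f}" "B = kfe a b c d"
    by (rule block_extends)
  then have Bs: "Bs = cyc a b c d e f" using is_design_eq_cyc assms(2) B by metis
  from assms(3) D(2) consider "z = a" | "z = b" | "z = c" | "z = d" | "z = e" | "z = f" by auto
  then show thesis
  proof cases
    case 1 then show thesis using that[of b c d e f] D Bs by simp
  next
    case 2 show thesis
      by (rule that[of a c d e f]) (use 2 D Bs in \<open>auto simp: cyc_swap\<close>)
  next
    case 3 show thesis
      by (rule that[of d e f a b]) (use 3 D Bs in \<open>auto simp: cyc_rotate\<close>)
  next
    case 4 show thesis
      by (rule that[of c e f a b]) (use 4 D Bs in \<open>auto simp: cyc_swap cyc_rotate\<close>)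
  next
    case 5 show thesis
      by (rule that[of f a b c d]) (use 5 D Bs in \<open>auto simp: cyc_rotate\<close>)
  next
    case 6 show thesis
      by (rule that[of e a b c d]) (use 6 D Bs in \<open>auto simp: cyc_swap cyc_rotate\<close>)
  qed
qed

section \<open>Common blocks and common triangles of two designs\<close>

lemma design_inter:
  assumes "card X = 6" "is_design X B1" "is_design X B2"
  shows "B1 = B2 \<or> B1 \<inter> B2 = {}"
proof -
  have "B1 = B2" if B: "B \<in> B1" "B \<in> B2" for B
  proof -
    have "is_block X B" using assms(2) B unfolding is_design_def by blast
    with assms(1) obtain a b c d e f where "distinct [a,b,c,d,e,f]" "X = {a,b,c,d,e,f}" "B = kfe a b c d"
      by (rule block_extends)
    then show ?thesis using is_design_eq_cyc assms(2,3) B by metis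
  qed
  then show ?thesis by blast
qed

text \<open>
  With the vertices numbered so that one design is \<open>cyc 0 1 2 3 4 5\<close>, the list \<open>[b,c,d,e,f]\<close>
  stands for the other design \<open>cyc 0 b c d e f\<close>; the second disjunct says that the two coincide.
  The permutations are built up one entry at a time, because listing all 5-tuples first is
  far too slow for \<open>code_simp\<close>.
\<close>
fun few_common :: "nat list \<Rightarrow> bool" where
  "few_common [b,c,d,e,f] \<longleftrightarrow>
    card (cyc_tri 0 1 2 3 4 5 \<inter> cyc_tri 0 b c d e f) \<in> {0,2,3} \<or>
    b = 1 \<and> {c,d} = {2,3} \<and> {e,f} = {4,5}"
| "few_common _ \<longleftrightarrow> True"

fun few_common_extensions :: "nat \<Rightarrow> nat list \<Rightarrow> bool" where
  "few_common_extensions 0 xs = few_common xs"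
| "few_common_extensions (Suc n) xs =
    list_all (few_common_extensions n) (filter distinct (map (\<lambda>y. y # xs) [1,2,3,4,5]))"

text \<open>Extensions are made at the front of the list, so the last entry of \<open>ys\<close> is
  the first one added; hence the induction from the right end.\<close>

lemma few_common_extensionsD:
  assumes "few_common_extensions (length ys) xs" "distinct (ys @ xs)" "set ys \<subseteq> {1,2,3,4,5}"
  shows "few_common (ys @ xs)"
  using assms
proof (induction ys arbitrary: xs rule: rev_induct)
  case (snoc y ys)
  have "y # xs \<in> set (filter distinct (map (\<lambda>y. y # xs) [1,2,3,4,5]))"
    using snoc.prems(2,3) by auto
  then have "few_common_extensions (length ys) (y # xs)"
    using snoc.prems(1) by (simp only: length_append_singleton few_common_extensions.simps list_all_iff)
  then show ?case
    using snoc.IH[of "y # xs"] snoc.prems(2,3) by simp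
qed simp

lemma few_common_distinct:
  assumes "distinct [b,c,d,e,f]" "{b,c,d,e,f} \<subseteq> {1,2,3,4,5}"
  shows "few_common [b,c,d,e,f]"
proof -
  \<comment> \<open>The evaluation ends in the 120 permutations of 1 to 5.\<close>
  have "few_common_extensions 5 []"
    by code_simp
  then have "few_common_extensions (length [b,c,d,e,f]) []"
    by (simp add: eval_nat_numeral del: few_common_extensions.simps)
  then have "few_common ([b,c,d,e,f] @ [])"
    by (rule few_common_extensionsD) (use assms in simp_all)
  then show ?thesis by (simp only: append_Nil2)
qed

text \<open>This transfers the count of common triangles from an arbitrary vertex set to the numbers
  0 to 5.\<close>

lemma cyc_tri_image:
  "cyc_tri (h a) (h b) (h c) (h d) (h e) (h f) = (`) h ` cyc_tri a b c d e f"
  by (simp add: cyc_tri_def)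

lemma design_Tri_inter:
  assumes card: "card X = 6" and design: "is_design X B1" "is_design X B2" and "B1 \<noteq> B2"
  shows "card (Tri B1 \<inter> Tri B2) \<in> {0,2,3}"
proof -
  obtain z where "z \<in> X" using card by fastforce
  with card design(1) obtain b c d e f where
    1: "distinct [z,b,c,d,e,f]" "X = {z,b,c,d,e,f}" "B1 = cyc z b c d e f"
    by (rule is_design_cases)
  from card design(2) \<open>z \<in> X\<close> obtain b' c' d' e' f' where
    2: "distinct [z,b',c',d',e',f']" "X = {z,b',c',d',e',f'}" "B2 = cyc z b' c' d' e' f'"
    by (rule is_design_cases)
  \<comment> \<open>The vertices are numbered along the first design, with \<open>z\<close> as 0;
    the second design then becomes an arrangement \<open>[0,i,j,k,l,m]\<close> of the same
    numbers.\<close>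
  define h where "h = nth [z,b,c,d,e,f]"
  have h: "h 0 = z" "h 1 = b" "h 2 = c" "h 3 = d" "h 4 = e" "h 5 = f"
    by (simp_all add: h_def)
  have inj: "inj_on h {0..<6}"
    unfolding h_def using 1(1) by (intro inj_on_nth) auto
  have range: "{0..<6::nat} = {0,1,2,3,4,5}" by auto
  have X: "X = h ` {0..<6}"
    by (simp only: range image_insert image_empty h 1(2))
  have "{b',c',d',e',f'} \<subseteq> h ` {0..<6}" using X 2(2) by blast
  then obtain i j k l m where ij: "b' = h i" "c' = h j" "d' = h k" "e' = h l" "f' = h m"
    and mem: "i \<in> {0..<6}" "j \<in> {0..<6}" "k \<in> {0..<6}" "l \<in> {0..<6}" "m \<in> {0..<6}"
    by auto
  have dist: "distinct [0,i,j,k,l,m]"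
  proof -
    have "distinct (map h [0,i,j,k,l,m])" using 2(1) by (simp add: ij h(1))
    then show ?thesis unfolding distinct_map by blast
  qed
  have idx: "{i,j,k,l,m} \<subseteq> {1,2,3,4,5}"
  proof -
    have "n \<in> {1,2,3,4,5}" if "n \<in> {0..<6}" "n \<noteq> 0" for n :: nat
      using that range by auto
    with mem show ?thesis using dist by simp
  qed
  have T1: "Tri B1 = (`) h ` cyc_tri 0 1 2 3 4 5"
    by (simp add: 1(3) Tri_cyc[OF 1(1)] cyc_tri_image[symmetric] h del: One_nat_def)
  have T2: "Tri B2 = (`) h ` cyc_tri 0 i j k l m"
    using Tri_cyc[OF 2(1)] cyc_tri_image[of h 0 i j k l m] by (simp add: 2(3) h(1) ij)
  \<comment> \<open>Injectivity of \<open>h\<close> is known on \<open>{0..<6}\<close> only, so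
    taking images is injective, and commutes with intersection, only for families of subsets of
    it.\<close>
  have sub: "cyc_tri 0 1 2 3 4 5 \<subseteq> Pow {0..<6::nat}" "cyc_tri 0 i j k l m \<subseteq> Pow {0..<6::nat}"
    using mem by (auto simp: cyc_tri_def)
  have "Tri B1 \<inter> Tri B2 = (`) h ` (cyc_tri 0 1 2 3 4 5 \<inter> cyc_tri 0 i j k l m)"
    unfolding T1 T2 using inj_on_image_Int[OF inj_on_image_Pow[OF inj] sub] by simp
  moreover have "inj_on ((`) h) (cyc_tri 0 1 2 3 4 5 \<inter> cyc_tri 0 i j k l m)"
    using inj_on_image_Pow[OF inj] sub by (rule_tac inj_on_subset) auto
  ultimately have eq: "card (Tri B1 \<inter> Tri B2) = card (cyc_tri 0 1 2 3 4 5 \<inter> cyc_tri 0 i j k l m)"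
    by (simp add: card_image)
  \<comment> \<open>The exceptional arrangements in \<open>few_common\<close> differ from the first
    design only by swaps inside pairs, which do not change a design.\<close>
  have "\<not> (i = 1 \<and> {j,k} = {2,3} \<and> {l,m} = {4,5})"
  proof
    assume "i = 1 \<and> {j,k} = {2,3} \<and> {l,m} = {4,5}"
    then have "B1 = B2"
      by (auto simp: 1(3) 2(3) ij h doubleton_eq_iff cyc_swap' simp del: One_nat_def)
    then show False using \<open>B1 \<noteq> B2\<close> by simp
  qed
  moreover have "few_common [i,j,k,l,m]"
    using few_common_distinct[OF _ idx] dist by (simp del: few_common.simps)
  ultimately show ?thesis
    unfolding eq few_common.simps by blast
qed

section \<open>The intersection numbers of order 6\<close>

lemma card_cyc_tri:
  assumes "distinct [a,b,c,d,e,f]"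
  shows "card (cyc_tri a b c d e f) = 6"
proof -
  \<comment> \<open>The reversed list supplies each inequality in its other orientation to the
    simplifier.\<close>
  have "distinct [f,e,d,c,b,a]" using assms by auto
  with assms show ?thesis by (simp add: cyc_tri_def card_insert_if set_eq_subset)
qed

text \<open>\<open>Fin 6\<close>, \<open>J 6\<close> and \<open>J_T 6\<close> can all be read off
  from this one relation: the first by putting \<open>n = t + 2 * s\<close>, the other two by
  projection.\<close>

lemma intersection_numbers_6:
  "(\<exists>(X::nat set) B1 B2. card X = 6 \<and> is_design X B1 \<and> is_design X B2 \<and>
      card (B1 \<inter> B2) = s \<and> card (Tri B1 \<inter> Tri B2) = n) \<longleftrightarrow>
    (s,n) \<in> {(0,0), (0,2), (0,3), (3,6)}" (is "?L \<longleftrightarrow> ?R")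
proof
  assume ?L
  then obtain X :: "nat set" and B1 B2 where
    *: "card X = 6" "is_design X B1" "is_design X B2" "card (B1 \<inter> B2) = s" "card (Tri B1 \<inter> Tri B2) = n"
    by blast
  show ?R
  proof (cases "B1 = B2")
    case True
    obtain z where "z \<in> X" using *(1) by fastforce
    with *(1,2) obtain b c d e f where
      "distinct [z,b,c,d,e,f]" "B1 = cyc z b c d e f" by (rule is_design_cases)
    then show ?thesis using * True by (auto simp: card_cyc Tri_cyc card_cyc_tri)
  next
    case False
    then show ?thesis using design_inter[OF *(1-3)] design_Tri_inter[OF *(1-3)] *(4,5) by auto
  qed
next
  let ?B = "cyc 0 1 2 3 4 (5::nat)" and ?X = "{0,1,2,3,4,5::nat}"
  have X: "card ?X = 6" by simp
  have design: "is_design ?X (cyc a b c d e f)"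
    if "distinct [a,b,c,d,e,f]" "{a,b,c,d,e,f} = ?X" for a b c d e f
    using is_design_cyc[OF that(1)] that(2) by simp
  have B: "is_design ?X ?B" by (rule design) auto
  have T: "Tri ?B = cyc_tri 0 1 2 3 4 5" by (rule Tri_cyc) simp
  \<comment> \<open>Equal designs would have 6 common triangles. So \<open>k \<noteq> 6\<close>
    makes the designs distinct, hence without common blocks, and only triangles remain to be
    counted.\<close>
  have other: "\<exists>(X::nat set) B1 B2. card X = 6 \<and> is_design X B1 \<and> is_design X B2 \<and>
      card (B1 \<inter> B2) = 0 \<and> card (Tri B1 \<inter> Tri B2) = k"
    if D: "distinct [a,b,c,d,e,f]" "{a,b,c,d,e,f} = ?X"
      and k: "card (cyc_tri 0 1 2 3 4 5 \<inter> cyc_tri a b c d e f) = k" "k \<noteq> 6" for a b c d e f k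
  proof -
    have "?B \<noteq> cyc a b c d e f"
      using k T Tri_cyc[OF D(1)] card_cyc_tri[of 0 1 2 3 4 "5::nat"] by auto
    then have "?B \<inter> cyc a b c d e f = {}"
      using design_inter[OF X B design[OF D]] by blast
    then show ?thesis using X B design[OF D] T Tri_cyc[OF D(1)] k(1) by (metis card.empty)
  qed
  assume ?R
  then consider "s = 0" "n = 0" | "s = 0" "n = 2" | "s = 0" "n = 3" | "s = 3" "n = 6" by auto
  then show ?L
  proof cases
    case 1
    \<comment> \<open>The same three pairs in the opposite cyclic order.\<close>
    have "card (cyc_tri 0 1 2 3 4 5 \<inter> cyc_tri 0 1 4 5 2 (3::nat)) = 0" by code_simp
    then show ?thesis unfolding 1 by (rule other[rotated 2]) auto
  next
    case 2
    \<comment> \<open>The first design with 3 and 4 exchanged; the common triangles are 012 and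
      234.\<close>
    have "card (cyc_tri 0 1 2 3 4 5 \<inter> cyc_tri 0 1 2 4 3 (5::nat)) = 2" by code_simp
    then show ?thesis unfolding 2 by (rule other[rotated 2]) auto
  next
    case 3
    \<comment> \<open>The pairs are the other three sides of the hexagon 012345, run through in the
      opposite direction; the common triangles are 012, 234 and 045, one from each block.\<close>
    have "card (cyc_tri 0 1 2 3 4 5 \<inter> cyc_tri 1 2 5 0 3 (4::nat)) = 3" by code_simp
    then show ?thesis unfolding 3 by (rule other[rotated 2]) auto
  next
    case 4
    have "card ?B = 3" "card (Tri ?B) = 6" unfolding T by (simp_all add: card_cyc card_cyc_tri)
    then show ?thesis unfolding 4 using X B by (metis inf.idem)
  qed
qed

theorem theorem4p3:
  shows "Fin 6 = Adm 6"
proof -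
  have Fin: "(s,t) \<in> Fin 6 \<longleftrightarrow> s = 0 \<and> (t = 0 \<or> t = 2 \<or> t = 3) \<or> s = 3 \<and> t = 0" for s t
    unfolding Fin_def mem_Collect_eq case_prod_conv intersection_numbers_6 by auto
  have "s \<in> J 6 \<longleftrightarrow> (\<exists>n::nat. (s,n) \<in> {(0,0), (0,2), (0,3), (3,6)})" for s
    unfolding J_def intersection_numbers_6[symmetric] by blast
  then have J: "s \<in> J 6 \<longleftrightarrow> s = 0 \<or> s = 3" for s
    by auto
  have "n \<in> J_T 6 \<longleftrightarrow> (\<exists>s::nat. (s,n) \<in> {(0,0), (0,2), (0,3), (3,6)})" for n
    unfolding J_T_def intersection_numbers_6[symmetric] by blast
  then have J_T: "n \<in> J_T 6 \<longleftrightarrow> n = 0 \<or> n = 2 \<or> n = 3 \<or> n = 6" for n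
    by auto
  have b: "b_num 6 = 3"
    by (simp add: b_num_def)
  \<comment> \<open>For \<open>s = 0\<close> the bound 3 rules out \<open>t = 6\<close>; for
    \<open>s = 3\<close> it forces \<open>t = 0\<close>, and then \<open>t + 2 * s = 6\<close> is
    indeed in \<open>J_T 6\<close>.\<close>
  have "(s,t) \<in> Fin 6 \<longleftrightarrow> (s,t) \<in> Adm 6" for s t
    unfolding Adm_def mem_Collect_eq case_prod_conv Fin J J_T b by presburger
  then show ?thesis by auto
qed

end
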